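(* Let $\mu_X \in \mathbb{R}$, $\epsilon \in \mathbb{R}$ with $\epsilon \neq 0$, and $\sigma^2 > 0$ (all unknown to the decision maker). Let $X \sim \phi_{\mu_X,\sigma^2}$ and $Z \sim \phi_{\mu_X+\epsilon,\sigma^2}$, and let $Y$ be drawn from the 50--50 mixture $\frac12 \phi_{\mu_X,\sigma^2} + \frac12 \phi_{\mu_X+\epsilon,\sigma^2}$, the draws being independent. Given the realized values $x, z, y$ of $X, Z, Y$, consider the decision rule for predicting which of the two component distributions $y$ was drawn from: $$C^{dist}(y) := \begin{cases} \phi_{\mu_X,\sigma^2} & \text{if } |x-y| < |z-y|,\\ \phi_{\mu_X+\epsilon,\sigma^2} & \text{if } |x-y| > |z-y|. \end{cases}$$ Then the probability that this rule is correct is greater than $1/2$, that is, $$\frac12\,\mathbb{P}\big(|X-Y|<|Z-Y| \,\big|\, Y\sim \phi_{\mu_X,\sigma^2}\big) + \frac12\,\mathbb{P}\big(|X-Y|>|Z-Y| \,\big|\, Y\sim \phi_{\mu_X+\epsilon,\sigma^2}\big) > \frac12 .$$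
   Context: $\phi_{m,s^2}$ denotes the Gaussian distribution (and its density) on $\mathbb{R}$ with mean $m$ and variance $s^2$. Drawing $Y$ from the 50--50 mixture means: a fair coin, independent of $X$ and $Z$, selects one of the two component distributions, and $Y$ is then drawn from the selected component, independently of $X$ and $Z$. The notation $\mathbb{P}(\,\cdot \mid Y\sim f)$ means the probability conditional on the selected component being $f$, i.e. the probability when $X, Z, Y$ are independent with $Y \sim f$. The rule is correct when the predicted component is the selected one. The parameters being unknown means only that the decision to predict the component that generated $x$ or the one that generated $z$ uses only the values $x, y, z$. *)

theory Defs
  imports "HOL-Probability.Probability"
begin

text \<open>The second parameter is the variance, whereas \<^const>\<open>normal_density\<close> takes the standard deviation.\<close>

definition gaussian :: "real \<Rightarrow> real \<Rightarrow> real measure" where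
  "gaussian m v = density lborel (\<lambda>x. ennreal (normal_density m (sqrt v) x))"

text \<open>Labels of the two mixture components: the one that generated \<open>x\<close> and the one that
  generated \<open>z\<close>.\<close>

datatype component = CompX | CompZ

fun component_law :: "real \<Rightarrow> real \<Rightarrow> real \<Rightarrow> component \<Rightarrow> real measure" where
  "component_law \<mu> \<epsilon> v CompX = gaussian \<mu> v"
| "component_law \<mu> \<epsilon> v CompZ = gaussian (\<mu> + \<epsilon>) v"

text \<open>The parameters are unknown to the decision maker, so the rule takes only the realized values
  and returns a component label. It makes no prediction on a tie.\<close>

definition C_dist :: "real \<Rightarrow> real \<Rightarrow> real \<Rightarrow> component option" where
  "C_dist x z y =
     (if \<bar>x - y\<bar> < \<bar>z - y\<bar> then Some CompX
      else if \<bar>x - y\<bar> > \<bar>z - y\<bar> then Some CompZ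
      else None)"

definition generated_events :: "'a measure \<Rightarrow> 'b measure \<Rightarrow> ('a \<Rightarrow> 'b) \<Rightarrow> 'a set set" where
  "generated_events M N f = sets (vimage_algebra (space M) f N)"

text \<open>Mutual independence of three random variables. The library's \<open>indep_vars\<close> requires all
  variables to have the same value type, hence the formulation through the generated
  \<open>\<sigma>\<close>-algebras.\<close>

definition indep_vars3 ::
  "'a measure \<Rightarrow> 'b measure \<Rightarrow> ('a \<Rightarrow> 'b) \<Rightarrow> 'c measure \<Rightarrow> ('a \<Rightarrow> 'c) \<Rightarrow>
    'd measure \<Rightarrow> ('a \<Rightarrow> 'd) \<Rightarrow> bool" where
  "indep_vars3 M N1 f1 N2 f2 N3 f3 \<longleftrightarrow>
     f1 \<in> measurable M N1 \<and> f2 \<in> measurable M N2 \<and> f3 \<in> measurable M N3 \<and>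
     prob_space.indep_sets M
       (\<lambda>i. [generated_events M N1 f1, generated_events M N2 f2, generated_events M N3 f3] ! i)
       {0, 1, 2}"

end

theory Submission
  imports Defs
begin

text \<open>
  Both conditional probabilities exceed \<open>1 / 2\<close>, and they are instances of one fact: if \<open>X\<close> and
  \<open>Y\<close> are drawn from a Gaussian law \<open>\<nu>\<close> with mean \<open>m\<close>, and \<open>Z\<close> from the same law shifted by
  \<open>e \<noteq> 0\<close>, all independently, then \<open>Y\<close> is nearer to \<open>X\<close> than to \<open>Z\<close> with probability above
  \<open>1 / 2\<close> (\<open>mean_closer_prob_gt_half\<close>). When \<open>Y\<close> comes from the other component, \<open>X\<close> and \<open>Z\<close>
  exchange roles and \<open>e\<close> changes sign.

  For that fact, integrate out \<open>Y\<close> first. Let \<open>h x z\<close> be the probability that \<open>Y\<close> is nearer to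
  \<open>x\<close> than to \<open>z\<close>. Then \<open>h x z > 1 / 2\<close> when \<open>x\<close> is nearer to \<open>m\<close> than \<open>z\<close> is
  (\<open>closer_prob_gt_half\<close>), and \<open>h x z + h z x = 1\<close> for \<open>x \<noteq> z\<close> (\<open>closer_prob_swap\<close>). Replacing
  the shifted law of \<open>Z\<close> by its density with respect to \<open>\<nu>\<close>, and averaging with the mirror image
  of the whole configuration about \<open>m\<close>, gives the wanted probability as the mean of
  \<open>w z * h x z\<close> over two independent draws \<open>x\<close>, \<open>z\<close> from \<open>\<nu>\<close>, where
  \<open>w z = c * cosh (e * (z - m) / v)\<close>, with \<open>v\<close> the variance, has mean 1 under \<open>\<nu>\<close>. Since \<open>w\<close>
  increases with the distance to \<open>m\<close>, the factors \<open>h x z - 1 / 2\<close> and \<open>w z - w x\<close> have the same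
  sign, and exchanging \<open>x\<close> and \<open>z\<close> concludes (\<open>weighted_comparison_gt_half\<close>).

  The passage from the random variables to these integrals is \<open>cond_prob_eq_integral\<close>: given the
  selected component, \<open>X\<close>, \<open>Z\<close> and \<open>Y\<close> are independent, with \<open>Y\<close> distributed according to that
  component.
\<close>

section \<open>Gaussian laws\<close>

lemma sets_gaussian [simp, measurable_cong]: "sets (gaussian m v) = sets borel"
  by (simp add: gaussian_def)

lemma space_gaussian [simp]: "space (gaussian m v) = UNIV"
  by (simp add: gaussian_def)

lemma prob_space_gaussian: "v > 0 \<Longrightarrow> prob_space (gaussian m v)"
  unfolding gaussian_def by (rule prob_space_normal_density) simp

lemma AE_gaussian_neq: "AE y in gaussian m v. y \<noteq> t"
  unfolding gaussian_def using AE_lborel_singleton[of t]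
  by (subst AE_density) auto

lemma distr_gaussian_reflect:
  "distr (gaussian m v) borel (\<lambda>x. t - x) = gaussian (t - m) v"
proof -
  have "gaussian (t - m) v = density (distr lborel borel (\<lambda>x. t - x)) (normal_density (t - m) (sqrt v))"
    using lborel_real_affine[of "-1" t] by (simp add: gaussian_def density_1)
  also have "\<dots> = distr (density lborel (\<lambda>x. normal_density (t - m) (sqrt v) (t - x))) borel (\<lambda>x. t - x)"
    by (subst density_distr) auto
  also have "(\<lambda>x. normal_density (t - m) (sqrt v) (t - x)) = normal_density m (sqrt v)"
    by (auto simp: normal_density_def power2_commute)
  finally show ?thesis
    by (simp add: gaussian_def)
qed

lemma gaussian_open_pos:
  assumes "v > 0" "open U" "U \<noteq> {}"
  shows "measure (gaussian m v) U > 0"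
proof -
  interpret prob_space "gaussian m v" by (rule prob_space_gaussian) fact
  have "emeasure (gaussian m v) U \<noteq> 0"
  proof
    assume "emeasure (gaussian m v) U = 0"
    then have "AE y in gaussian m v. y \<notin> U"
      using \<open>open U\<close> by (intro AE_not_in) (auto simp: null_sets_def)
    then have "AE y in lborel. y \<notin> U"
      using \<open>v > 0\<close> unfolding gaussian_def
      by (subst (asm) AE_density) (auto simp: normal_density_pos)
    then have "emeasure lborel U = 0"
      using \<open>open U\<close> by (subst (asm) AE_iff_measurable[of U]) auto
    then show False
      using open_not_negligible[OF \<open>open U\<close> \<open>U \<noteq> {}\<close>] \<open>open U\<close>
      by (auto simp: negligible_iff_null_sets null_sets_def)
  qed
  then show ?thesis
    by (simp add: emeasure_eq_measure zero_less_measure_iff)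
qed

text \<open>Moving the mean by \<open>e\<close> reweights the law by a function that is log-linear in \<open>z\<close>. This
  lets the three samples be treated as independent draws from one law, with a weight on the
  shifted one.\<close>

lemma gaussian_tilt:
  assumes "v > 0"
  shows "gaussian (m + e) v = density (gaussian m v) (\<lambda>z. exp ((2 * e * (z - m) - e\<^sup>2) / (2 * v)))"
proof -
  have "normal_density (m + e) (sqrt v) z
      = normal_density m (sqrt v) z * exp ((2 * e * (z - m) - e\<^sup>2) / (2 * v))" for z
    using assms by (simp add: normal_density_def exp_add[symmetric] add_divide_distrib[symmetric])
      (simp add: power2_eq_square field_simps)
  then show ?thesis
    unfolding gaussian_def by (subst density_density_eq) (auto simp: ennreal_mult[symmetric])
qed

section \<open>Being the nearer of two points to a Gaussian sample\<close>

definition closer_prob :: "real \<Rightarrow> real \<Rightarrow> real \<Rightarrow> real \<Rightarrow> real" where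
  "closer_prob m v x z = measure (gaussian m v) {y. \<bar>x - y\<bar> < \<bar>z - y\<bar>}"

lemma measurable_closer_prob [measurable]:
  assumes "v > 0"
  shows "(\<lambda>p. closer_prob m v (fst p) (snd p)) \<in> borel_measurable (borel \<Otimes>\<^sub>M borel)"
proof -
  interpret prob_space "gaussian m v" by (rule prob_space_gaussian) fact
  have "{q \<in> space ((borel \<Otimes>\<^sub>M borel) \<Otimes>\<^sub>M gaussian m v). \<bar>fst (fst q) - snd q\<bar> < \<bar>snd (fst q) - snd q\<bar>}
      \<in> sets ((borel \<Otimes>\<^sub>M borel) \<Otimes>\<^sub>M gaussian m v)"
    by measurable
  from measurable_emeasure_Pair[OF this] show ?thesis
    by (simp add: closer_prob_def measure_def space_pair_measure vimage_def)
qed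

text \<open>The only point equidistant from \<open>x\<close> and \<open>z\<close> is their midpoint, a null set.\<close>

lemma closer_prob_swap:
  assumes "v > 0" "x \<noteq> z"
  shows "closer_prob m v x z + closer_prob m v z x = 1"
proof -
  interpret prob_space "gaussian m v" by (rule prob_space_gaussian) fact
  have meas: "{y. \<bar>x - y\<bar> < \<bar>z - y\<bar>} \<in> events" for x z :: real
    by simp
  have "closer_prob m v x z + closer_prob m v z x
      = prob ({y. \<bar>x - y\<bar> < \<bar>z - y\<bar>} \<union> {y. \<bar>z - y\<bar> < \<bar>x - y\<bar>})"
    unfolding closer_prob_def by (subst finite_measure_Union) (auto simp: meas)
  also have "\<dots> = 1"
  proof (subst prob_eq_1)
    show "AE y in gaussian m v. y \<in> {y. \<bar>x - y\<bar> < \<bar>z - y\<bar>} \<union> {y. \<bar>z - y\<bar> < \<bar>x - y\<bar>}"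
      using AE_gaussian_neq[where t = "(x + z) / 2"]
      by eventually_elim (use \<open>x \<noteq> z\<close> in \<open>auto simp: field_simps abs_if split: if_splits\<close>)
  qed (auto intro!: sets.Un)
  finally show ?thesis .
qed

lemma closer_prob_reflect: "closer_prob m v (2 * m - x) (2 * m - z) = closer_prob m v x z"
proof -
  have "closer_prob m v (2 * m - x) (2 * m - z)
      = measure (distr (gaussian m v) borel (\<lambda>y. 2 * m - y)) {y. \<bar>(2 * m - x) - y\<bar> < \<bar>(2 * m - z) - y\<bar>}"
    by (simp add: closer_prob_def distr_gaussian_reflect)
  also have "\<dots> = closer_prob m v x z"
    by (subst measure_distr) (auto simp: closer_prob_def vimage_def abs_minus_commute)
  finally show ?thesis .
qed

text \<open>The points nearer to \<open>x\<close> than to \<open>z\<close> form a half-line containing the mean in its interior.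
  Together with its mirror image about the mean, which has the same mass, it covers the line, and
  the overlap of the two is a neighbourhood of the mean, so that twice the mass exceeds 1.\<close>

lemma closer_prob_gt_half:
  assumes "v > 0" "\<bar>x - m\<bar> < \<bar>z - m\<bar>"
  shows "closer_prob m v x z > 1 / 2"
proof -
  interpret prob_space "gaussian m v" by (rule prob_space_gaussian) fact
  define H where "H = {y. \<bar>x - y\<bar> < \<bar>z - y\<bar>}"
  define H' where "H' = {y. \<bar>(2 * m - x) - y\<bar> < \<bar>(2 * m - z) - y\<bar>}"
  have H: "H \<in> events" "H' \<in> events"
    by (simp_all add: H_def H'_def)
  have cover: "H \<union> H' = UNIV"
  proof -
    have "y \<in> H \<or> y \<in> H'" for y
      using assms(2) unfolding H_def H'_def by (auto simp: abs_if split: if_splits)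
    then show ?thesis by auto
  qed
  have "open (H \<inter> H')"
    unfolding H_def H'_def by (intro open_Int open_Collect_less continuous_intros)
  moreover have "m \<in> H \<inter> H'"
    using assms(2) by (auto simp: H_def H'_def)
  ultimately have "prob (H \<inter> H') > 0"
    using gaussian_open_pos[OF \<open>v > 0\<close>] by blast
  moreover have "prob H + prob H' = prob (H \<union> H') + prob (H \<inter> H')"
    using finite_measure_Union'[of H H'] finite_measure_Diff'[of H' H] H by (simp add: Int_commute)
  moreover have "prob (H \<union> H') = 1"
    using prob_space by (simp add: cover)
  moreover have "prob H' = prob H"
    using closer_prob_reflect by (simp add: closer_prob_def H_def H'_def)
  ultimately show ?thesis
    by (simp add: closer_prob_def H_def)
qed

section \<open>A comparison under two exchangeable draws\<close>

text \<open>Exchanging the two draws turns the integral of \<open>w z * h x z\<close> into that of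
  \<open>w x * (1 - h x z)\<close>. The sum of the two integrands exceeds \<open>(w x + w z) / 2\<close> by exactly \<open>(h x z - 1/2) * (w z - w x)\<close>.\<close>

lemma weighted_comparison_gt_half:
  fixes h :: "'a \<Rightarrow> 'a \<Rightarrow> real" and w :: "'a \<Rightarrow> real"
  assumes "prob_space N"
    and h [measurable]: "(\<lambda>p. h (fst p) (snd p)) \<in> borel_measurable (N \<Otimes>\<^sub>M N)"
    and bounded: "\<And>x z. 0 \<le> h x z \<and> h x z \<le> 1"
    and w: "integrable N w"
    and swap: "AE p in N \<Otimes>\<^sub>M N. h (fst p) (snd p) + h (snd p) (fst p) = 1"
    and sign: "AE p in N \<Otimes>\<^sub>M N. 0 < (h (fst p) (snd p) - 1 / 2) * (w (snd p) - w (fst p))"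
  shows "(\<integral>x. w x \<partial>N) / 2 < (\<integral>p. w (snd p) * h (fst p) (snd p) \<partial>(N \<Otimes>\<^sub>M N))"
proof -
  interpret N: prob_space N by fact
  interpret NN: pair_prob_space N N ..
  note [measurable] = borel_measurable_integrable[OF w]
  have w1: "integrable (N \<Otimes>\<^sub>M N) (\<lambda>p. w (fst p))" and w1_eq: "(\<integral>p. w (fst p) \<partial>(N \<Otimes>\<^sub>M N)) = (\<integral>x. w x \<partial>N)"
    using w integrable_distr_eq[of fst "N \<Otimes>\<^sub>M N" N w] integral_distr[of fst "N \<Otimes>\<^sub>M N" N w]
    by (simp_all add: N.distr_pair_fst)
  have w2: "integrable (N \<Otimes>\<^sub>M N) (\<lambda>p. w (snd p))"
    using NN.integrable_product_swap[OF w1] by (simp add: split_beta')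
  have w2_eq: "(\<integral>p. w (snd p) \<partial>(N \<Otimes>\<^sub>M N)) = (\<integral>x. w x \<partial>N)"
    using NN.integral_product_swap[of "\<lambda>p. w (fst p)"] by (simp add: split_beta' w1_eq)
  let ?L = "\<lambda>p. w (snd p) * h (fst p) (snd p)" and ?R = "\<lambda>p. w (fst p) * h (snd p) (fst p)"
  have L: "integrable (N \<Otimes>\<^sub>M N) ?L"
    by (rule Bochner_Integration.integrable_bound[OF w2])
      (use bounded in \<open>auto simp: abs_mult intro!: mult_left_le\<close>)
  have R: "integrable (N \<Otimes>\<^sub>M N) ?R"
    using NN.integrable_product_swap[OF L] by (simp add: split_beta')
  have RL: "(\<integral>p. ?R p \<partial>(N \<Otimes>\<^sub>M N)) = (\<integral>p. ?L p \<partial>(N \<Otimes>\<^sub>M N))"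
    using NN.integral_product_swap[of ?L] by (simp add: split_beta')
  have "(\<integral>p. (w (fst p) + w (snd p)) / 2 \<partial>(N \<Otimes>\<^sub>M N)) < (\<integral>p. ?L p + ?R p \<partial>(N \<Otimes>\<^sub>M N))"
  proof (rule NN.P.integral_less_AE_space)
    show "AE p in N \<Otimes>\<^sub>M N. (w (fst p) + w (snd p)) / 2 < ?L p + ?R p"
      using swap sign
    proof eventually_elim
      case (elim p)
      from elim(1) have "h (snd p) (fst p) = 1 - h (fst p) (snd p)" by simp
      with elim(2) show ?case by (simp only:) (simp add: algebra_simps add_divide_distrib)
    qed
  qed (use w1 w2 L R NN.P.emeasure_space_1 in auto)
  then show ?thesis
    using w1 w2 L R by (simp add: w1_eq w2_eq RL)
qed

lemma cosh_less_iff_abs: "cosh x < cosh y \<longleftrightarrow> \<bar>x\<bar> < \<bar>y\<bar>" for x y :: real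
  using cosh_real_nonneg_less_iff[of "\<bar>x\<bar>" "\<bar>y\<bar>"] by simp

section \<open>Two centred samples against a shifted one\<close>

text \<open>The weight obtained from a shift by \<open>e\<close> alone is monotone in \<open>z\<close>, whereas \<open>closer_prob\<close>
  compares distances to \<open>m\<close>. Reflection about \<open>m\<close> shows that shifts by \<open>e\<close> and \<open>- e\<close> give
  the same integral, so the average of both weights may be used; it is a multiple of a hyperbolic
  cosine, hence increasing in the distance to \<open>m\<close>.\<close>

lemma mean_closer_prob_gt_half:
  assumes "e \<noteq> 0" "v > 0"
  shows "1 / 2 < (\<integral>p. closer_prob m v (fst p) (snd p) \<partial>(gaussian m v \<Otimes>\<^sub>M gaussian (m + e) v))"
proof -
  let ?N = "gaussian m v" and ?h = "\<lambda>p. closer_prob m v (fst p) (snd p)"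
  interpret N: prob_space ?N by (rule prob_space_gaussian) fact
  interpret NN: pair_prob_space ?N ?N ..
  note [measurable] = measurable_closer_prob[OF \<open>v > 0\<close>]
  define L where "L e z = exp ((2 * e * (z - m) - e\<^sup>2) / (2 * v))" for e z
  have [measurable]: "L e \<in> borel_measurable borel" for e
    unfolding L_def by measurable
  have tilt: "gaussian (m + e) v = density ?N (L e)" for e
    using gaussian_tilt[OF \<open>v > 0\<close>] by (simp add: L_def)
  have L_int: "integrable ?N (L e)" and L_1: "(\<integral>z. L e z \<partial>?N) = 1" for e
  proof -
    interpret P: prob_space "gaussian (m + e) v" by (rule prob_space_gaussian) fact
    have "(\<integral>\<^sup>+z. ennreal (L e z) \<partial>?N) = 1"
      using P.emeasure_space_1 by (simp add: tilt emeasure_density)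
    then show "integrable ?N (L e)" "(\<integral>z. L e z \<partial>?N) = 1"
      by (auto simp: L_def intro!: integrableI_nonneg integral_eq_nn_integral[THEN trans])
  qed
  have as_weight: "(\<integral>p. ?h p \<partial>(?N \<Otimes>\<^sub>M gaussian (m + e) v))
      = (\<integral>p. L e (snd p) * ?h p \<partial>(?N \<Otimes>\<^sub>M ?N))" for e
  proof -
    interpret P: prob_space "gaussian (m + e) v" by (rule prob_space_gaussian) fact
    have "?N \<Otimes>\<^sub>M gaussian (m + e) v = density ?N (\<lambda>_. 1) \<Otimes>\<^sub>M density ?N (L e)"
      by (simp add: density_1 tilt)
    also have "\<dots> = density (?N \<Otimes>\<^sub>M ?N) (\<lambda>p. L e (snd p))"
      using P.sigma_finite_measure_axioms N.sigma_finite_measure_axioms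
      by (subst pair_measure_density) (simp_all add: tilt split_beta')
    finally show ?thesis
      by (simp add: integral_density L_def)
  qed
  have reflect: "(\<integral>p. ?h p \<partial>(?N \<Otimes>\<^sub>M gaussian (m - e) v)) = (\<integral>p. ?h p \<partial>(?N \<Otimes>\<^sub>M gaussian (m + e) v))"
  proof -
    interpret P: prob_space "gaussian (m - e) v" by (rule prob_space_gaussian) fact
    let ?T = "\<lambda>x. 2 * m - x"
    have "?N \<Otimes>\<^sub>M gaussian (m - e) v = distr ?N borel ?T \<Otimes>\<^sub>M distr (gaussian (m + e) v) borel ?T"
      by (simp add: distr_gaussian_reflect)
    also have "\<dots> = distr (?N \<Otimes>\<^sub>M gaussian (m + e) v) (borel \<Otimes>\<^sub>M borel) (\<lambda>(x, z). (?T x, ?T z))"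
      using P.sigma_finite_measure_axioms
      by (intro pair_measure_distr) (simp_all add: distr_gaussian_reflect)
    finally show ?thesis
      by (simp add: integral_distr split_beta' closer_prob_reflect)
  qed
  define w where "w z = (L e z + L (- e) z) / 2" for z
  have w_cosh: "w z = exp (- (e\<^sup>2) / (2 * v)) * cosh (e * (z - m) / v)" for z
  proof -
    have "L e z = exp (- (e\<^sup>2) / (2 * v)) * exp (e * (z - m) / v)" for e
      by (simp add: L_def exp_add[symmetric] diff_divide_distrib)
    from this[of e] this[of "- e"] show ?thesis
      by (simp add: w_def cosh_field_def distrib_left add_divide_distrib)
  qed
  have w_less: "w x < w z \<longleftrightarrow> \<bar>x - m\<bar> < \<bar>z - m\<bar>" for x z
    using assms by (simp add: w_cosh cosh_less_iff_abs abs_mult divide_less_cancel)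
  have sign: "0 < (closer_prob m v x z - 1 / 2) * (w z - w x)"
    if "x \<noteq> z" "\<bar>x - m\<bar> \<noteq> \<bar>z - m\<bar>" for x z
  proof (cases "\<bar>x - m\<bar> < \<bar>z - m\<bar>")
    case True
    then show ?thesis
      using closer_prob_gt_half[OF \<open>v > 0\<close> True] by (simp add: w_less)
  next
    case False
    with that have "\<bar>z - m\<bar> < \<bar>x - m\<bar>" by simp
    then show ?thesis
      using closer_prob_gt_half[of v z m x] closer_prob_swap[of v x z m] \<open>v > 0\<close> \<open>x \<noteq> z\<close> w_less[of z x]
      by (intro mult_neg_neg) auto
  qed
  have generic: "AE p in ?N \<Otimes>\<^sub>M ?N. fst p \<noteq> snd p \<and> \<bar>fst p - m\<bar> \<noteq> \<bar>snd p - m\<bar>"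
  proof (rule NN.AE_pair_measure)
    show "AE x in ?N. AE z in ?N. fst (x, z) \<noteq> snd (x, z) \<and> \<bar>fst (x, z) - m\<bar> \<noteq> \<bar>snd (x, z) - m\<bar>"
    proof (rule AE_I2)
      fix x
      show "AE z in ?N. fst (x, z) \<noteq> snd (x, z) \<and> \<bar>fst (x, z) - m\<bar> \<noteq> \<bar>snd (x, z) - m\<bar>"
        using AE_gaussian_neq[where t = x] AE_gaussian_neq[where t = "2 * m - x"]
        by eventually_elim (auto simp: abs_if split: if_splits)
    qed
  qed measurable
  have "(\<integral>z. w z \<partial>?N) / 2 < (\<integral>p. w (snd p) * ?h p \<partial>(?N \<Otimes>\<^sub>M ?N))"
  proof (rule weighted_comparison_gt_half)
    show "AE p in ?N \<Otimes>\<^sub>M ?N. closer_prob m v (fst p) (snd p) + closer_prob m v (snd p) (fst p) = 1"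
      using generic by eventually_elim (simp add: closer_prob_swap \<open>v > 0\<close>)
    show "AE p in ?N \<Otimes>\<^sub>M ?N. 0 < (closer_prob m v (fst p) (snd p) - 1 / 2) * (w (snd p) - w (fst p))"
      using generic by eventually_elim (simp add: sign)
    show "integrable ?N w"
      unfolding w_def using L_int by auto
    show "0 \<le> closer_prob m v x z \<and> closer_prob m v x z \<le> 1" for x z
      by (simp add: closer_prob_def)
  qed (simp_all add: N.prob_space_axioms)
  also have "(\<integral>z. w z \<partial>?N) = 1"
    unfolding w_def using L_int by (simp add: L_1)
  also have "(\<integral>p. w (snd p) * ?h p \<partial>(?N \<Otimes>\<^sub>M ?N)) = (\<integral>p. ?h p \<partial>(?N \<Otimes>\<^sub>M gaussian (m + e) v))"
  proof -
    have int: "integrable (?N \<Otimes>\<^sub>M ?N) (\<lambda>p. L e (snd p) * ?h p)" for e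
    proof (rule Bochner_Integration.integrable_bound)
      have "integrable (?N \<Otimes>\<^sub>M ?N) (\<lambda>p. L e (fst p))"
        using L_int integrable_distr_eq[of fst "?N \<Otimes>\<^sub>M ?N" ?N "L e"] by (simp add: N.distr_pair_fst)
      from NN.integrable_product_swap[OF this]
      show "integrable (?N \<Otimes>\<^sub>M ?N) (\<lambda>p. L e (snd p))" by (simp add: split_beta')
    qed (auto simp: closer_prob_def L_def intro!: mult_left_le)
    have "(\<integral>p. w (snd p) * ?h p \<partial>(?N \<Otimes>\<^sub>M ?N))
        = (\<integral>p. (L e (snd p) * ?h p + L (- e) (snd p) * ?h p) / 2 \<partial>(?N \<Otimes>\<^sub>M ?N))"
      by (simp add: w_def algebra_simps add_divide_distrib)
    also have "\<dots> = ((\<integral>p. L e (snd p) * ?h p \<partial>(?N \<Otimes>\<^sub>M ?N)) + (\<integral>p. L (- e) (snd p) * ?h p \<partial>(?N \<Otimes>\<^sub>M ?N))) / 2"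
      using int by simp
    also have "\<dots> = (\<integral>p. ?h p \<partial>(?N \<Otimes>\<^sub>M gaussian (m + e) v))"
      using as_weight[of e] as_weight[of "- e"] reflect by simp
    finally show ?thesis .
  qed
  finally show ?thesis .
qed

section \<open>Conditioning on the selected component\<close>

lemma indep_vars3_prob_12:
  assumes M: "prob_space M" and indep: "indep_vars3 M N1 f1 N2 f2 N3 f3"
    and A: "A \<in> sets N1" and B: "B \<in> sets N2"
  shows "measure M (f1 -` A \<inter> f2 -` B \<inter> space M)
      = measure M (f1 -` A \<inter> space M) * measure M (f2 -` B \<inter> space M)"
proof -
  interpret prob_space M by fact
  let ?F = "\<lambda>i::nat. [generated_events M N1 f1, generated_events M N2 f2, generated_events M N3 f3] ! i"
  have "prob (\<Inter>i\<in>{0, 1}. [f1 -` A \<inter> space M, f2 -` B \<inter> space M] ! i)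
      = (\<Prod>i\<in>{0, 1}. prob ([f1 -` A \<inter> space M, f2 -` B \<inter> space M] ! i))"
  proof (rule indep_setsD)
    show "indep_sets ?F {0, 1, 2}"
      using indep by (simp add: indep_vars3_def)
  qed (use A B in \<open>auto simp: generated_events_def in_vimage_algebra\<close>)
  moreover have "f1 -` A \<inter> f2 -` B \<inter> space M = (f1 -` A \<inter> space M) \<inter> (f2 -` B \<inter> space M)"
    by auto
  ultimately show ?thesis
    by simp
qed

text \<open>Events of the form \<open>(f1, f2) \<in> E\<close> with \<open>E\<close> not a rectangle are reached because grouping
  the first two \<open>\<sigma>\<close>-algebras of an independent triple leaves the join independent of the third.\<close>

lemma indep_vars3_prob_pair:
  assumes M: "prob_space M" and indep: "indep_vars3 M N1 f1 N2 f2 N3 f3"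
    and E: "E \<in> sets (N1 \<Otimes>\<^sub>M N2)" and D: "D \<in> sets N3"
  shows "measure M ((\<lambda>\<omega>. (f1 \<omega>, f2 \<omega>)) -` E \<inter> f3 -` D \<inter> space M)
      = measure M ((\<lambda>\<omega>. (f1 \<omega>, f2 \<omega>)) -` E \<inter> space M) * measure M (f3 -` D \<inter> space M)"
proof -
  interpret prob_space M by fact
  let ?F = "\<lambda>i::nat. [generated_events M N1 f1, generated_events M N2 f2, generated_events M N3 f3] ! i"
  have rv: "f1 \<in> measurable M N1" "f2 \<in> measurable M N2"
    and F: "indep_sets ?F {0, 1, 2}"
    using indep by (simp_all add: indep_vars3_def)
  have gen1: "f1 -` A \<inter> space M \<in> ?F 0" if "A \<in> sets N1" for A
    using that by (simp add: generated_events_def in_vimage_algebra)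
  have gen2: "f2 -` A \<inter> space M \<in> ?F 1" if "A \<in> sets N2" for A
    using that by (simp add: generated_events_def in_vimage_algebra)
  have gen3: "f3 -` A \<inter> space M \<in> ?F 2" if "A \<in> sets N3" for A
    using that by (simp add: generated_events_def in_vimage_algebra)
  define I :: "bool \<Rightarrow> nat set" where "I = case_bool {0, 1} {2}"
  have "indep_sets (\<lambda>b. sigma_sets (space M) (\<Union>i\<in>I b. ?F i)) UNIV"
  proof (rule indep_sets_collect_sigma)
    show "indep_sets ?F (\<Union>b\<in>UNIV. I b)"
      using F by (simp add: I_def UNIV_bool insert_commute)
    show "disjoint_family_on I UNIV"
      by (auto simp: I_def disjoint_family_on_def split: bool.splits)
    show "Int_stable (?F i)" if "i \<in> I b" for i b
      using that by (auto simp: I_def generated_events_def Int_stable_def split: bool.splits)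
  qed
  then have "indep_set (sigma_sets (space M) (?F 0 \<union> ?F 1)) (sigma_sets (space M) (?F 2))"
    unfolding indep_set_def
  proof (rule back_subst[where P = "\<lambda>G. indep_sets G UNIV"], intro ext)
    show "sigma_sets (space M) (\<Union>i\<in>I b. ?F i)
        = case_bool (sigma_sets (space M) (?F 0 \<union> ?F 1)) (sigma_sets (space M) (?F 2)) b" for b
      by (cases b) (simp_all add: I_def)
  qed
  moreover have "(\<lambda>\<omega>. (f1 \<omega>, f2 \<omega>)) -` E \<inter> space M \<in> sigma_sets (space M) (?F 0 \<union> ?F 1)"
  proof -
    let ?G = "?F 0 \<union> ?F 1"
    have "?G \<subseteq> Pow (space M)"
      using sets.space_closed[of "vimage_algebra (space M) f1 N1"]
        sets.space_closed[of "vimage_algebra (space M) f2 N2"]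
      by (auto simp: generated_events_def)
    then have G: "sets (sigma (space M) ?G) = sigma_sets (space M) ?G" "space (sigma (space M) ?G) = space M"
      by (rule sets_measure_of, rule space_measure_of)
    have "f1 \<in> measurable (sigma (space M) ?G) N1"
      by (rule measurableI) (use G rv(1) gen1 in \<open>auto simp: measurable_space intro!: sigma_sets.Basic\<close>)
    moreover have "f2 \<in> measurable (sigma (space M) ?G) N2"
      by (rule measurableI) (use G rv(2) gen2 in \<open>auto simp: measurable_space intro!: sigma_sets.Basic\<close>)
    ultimately have "(\<lambda>\<omega>. (f1 \<omega>, f2 \<omega>)) \<in> measurable (sigma (space M) ?G) (N1 \<Otimes>\<^sub>M N2)"
      by (rule measurable_Pair)
    from measurable_sets[OF this E] show ?thesis
      unfolding G .
  qed
  moreover have "f3 -` D \<inter> space M \<in> sigma_sets (space M) (?F 2)"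
    using gen3[OF D] by (rule sigma_sets.Basic)
  ultimately have "prob (((\<lambda>\<omega>. (f1 \<omega>, f2 \<omega>)) -` E \<inter> space M) \<inter> (f3 -` D \<inter> space M))
      = prob ((\<lambda>\<omega>. (f1 \<omega>, f2 \<omega>)) -` E \<inter> space M) * prob (f3 -` D \<inter> space M)"
    by (rule indep_setD)
  moreover have "(\<lambda>\<omega>. (f1 \<omega>, f2 \<omega>)) -` E \<inter> f3 -` D \<inter> space M
      = ((\<lambda>\<omega>. (f1 \<omega>, f2 \<omega>)) -` E \<inter> space M) \<inter> (f3 -` D \<inter> space M)"
    by auto
  ultimately show ?thesis
    by simp
qed

text \<open>The pair \<open>(S, Y)\<close>, whose entries may depend on each other, is independent of
  \<open>(f1, f2)\<close>: conditioning on a value of \<open>S\<close> therefore changes the law of \<open>Y\<close> alone and keeps the three variables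
  independent.\<close>

lemma distr_cond_eq_pair_measure:
  assumes M: "prob_space M"
    and indep: "indep_vars3 M N1 f1 N2 f2 (count_space UNIV \<Otimes>\<^sub>M N3) (\<lambda>\<omega>. (S \<omega>, Y \<omega>))"
    and pos: "\<P>(\<omega> in M. S \<omega> = c) > 0"
  defines "Mc \<equiv> uniform_measure M {\<omega> \<in> space M. S \<omega> = c}"
  shows "distr Mc ((N1 \<Otimes>\<^sub>M N2) \<Otimes>\<^sub>M N3) (\<lambda>\<omega>. ((f1 \<omega>, f2 \<omega>), Y \<omega>))
      = (distr M N1 f1 \<Otimes>\<^sub>M distr M N2 f2) \<Otimes>\<^sub>M distr Mc N3 Y"
proof -
  interpret prob_space M by fact
  have f1 [measurable]: "f1 \<in> measurable M N1" and f2 [measurable]: "f2 \<in> measurable M N2"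
    and SY: "(\<lambda>\<omega>. (S \<omega>, Y \<omega>)) \<in> measurable M (count_space UNIV \<Otimes>\<^sub>M N3)"
    using indep by (simp_all add: indep_vars3_def)
  have S [measurable]: "S \<in> measurable M (count_space UNIV)" and Y [measurable]: "Y \<in> measurable M N3"
    using measurable_compose[OF SY measurable_fst] measurable_compose[OF SY measurable_snd] by simp_all
  let ?c = "{\<omega> \<in> space M. S \<omega> = c}"
  have c [measurable]: "?c \<in> events" by measurable
  have c0: "emeasure M ?c \<noteq> 0" "emeasure M ?c \<noteq> \<infinity>"
    using pos by (simp_all add: emeasure_eq_measure)
  have [measurable_cong]: "sets Mc = events" and [simp]: "space Mc = space M"
    by (simp_all add: Mc_def)
  interpret Mc: prob_space Mc
    unfolding Mc_def by (rule prob_space_uniform_measure[OF c0])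
  have distr12: "distr M (N1 \<Otimes>\<^sub>M N2) (\<lambda>\<omega>. (f1 \<omega>, f2 \<omega>)) = distr M N1 f1 \<Otimes>\<^sub>M distr M N2 f2"
  proof (rule pair_measure_eqI[symmetric])
    fix A B assume "A \<in> sets (distr M N1 f1)" "B \<in> sets (distr M N2 f2)"
    then have AB [measurable]: "A \<in> sets N1" "B \<in> sets N2" by simp_all
    have "(\<lambda>\<omega>. (f1 \<omega>, f2 \<omega>)) -` (A \<times> B) \<inter> space M = f1 -` A \<inter> (f2 -` B) \<inter> space M"
      by auto
    then show "emeasure (distr M N1 f1) A * emeasure (distr M N2 f2) B
        = emeasure (distr M (N1 \<Otimes>\<^sub>M N2) (\<lambda>\<omega>. (f1 \<omega>, f2 \<omega>))) (A \<times> B)"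
      using indep_vars3_prob_12[OF M indep AB] by (simp add: emeasure_distr emeasure_eq_measure ennreal_mult)
  qed (auto intro!: prob_space_imp_sigma_finite prob_space_distr cong: sets_pair_measure_cong)
  have prob12: "prob_space (distr M N1 f1 \<Otimes>\<^sub>M distr M N2 f2)"
    unfolding distr12[symmetric] by (rule prob_space_distr) measurable
  have sets12: "sets (distr M N1 f1 \<Otimes>\<^sub>M distr M N2 f2) = sets (N1 \<Otimes>\<^sub>M N2)"
    by (simp cong: sets_pair_measure_cong)
  show ?thesis
  proof (rule pair_measure_eqI[symmetric])
    fix E D assume "E \<in> sets (distr M N1 f1 \<Otimes>\<^sub>M distr M N2 f2)" "D \<in> sets (distr Mc N3 Y)"
    then have E [measurable]: "E \<in> sets (N1 \<Otimes>\<^sub>M N2)" and D [measurable]: "D \<in> sets N3"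
      by (simp_all add: sets12)
    have "{c} \<times> D \<in> sets (count_space UNIV \<Otimes>\<^sub>M N3)" by simp
    note indep_vars3_prob_pair[OF M indep E this]
    moreover have "(\<lambda>\<omega>. (S \<omega>, Y \<omega>)) -` ({c} \<times> D) \<inter> space M = ?c \<inter> (Y -` D \<inter> space M)"
      by auto
    moreover have "(\<lambda>\<omega>. (f1 \<omega>, f2 \<omega>)) -` E \<inter> ((\<lambda>\<omega>. (S \<omega>, Y \<omega>)) -` ({c} \<times> D)) \<inter> space M
        = ?c \<inter> ((\<lambda>\<omega>. ((f1 \<omega>, f2 \<omega>), Y \<omega>)) -` (E \<times> D) \<inter> space M)"
      by auto
    ultimately have "prob (?c \<inter> ((\<lambda>\<omega>. ((f1 \<omega>, f2 \<omega>), Y \<omega>)) -` (E \<times> D) \<inter> space M))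
        = prob ((\<lambda>\<omega>. (f1 \<omega>, f2 \<omega>)) -` E \<inter> space M) * prob (?c \<inter> (Y -` D \<inter> space M))"
      by simp
    then have "Mc.prob ((\<lambda>\<omega>. ((f1 \<omega>, f2 \<omega>), Y \<omega>)) -` (E \<times> D) \<inter> space M)
        = prob ((\<lambda>\<omega>. (f1 \<omega>, f2 \<omega>)) -` E \<inter> space M) * Mc.prob (Y -` D \<inter> space M)"
      unfolding Mc_def by (subst (1 2) measure_uniform_measure[OF c0]) simp_all
    then show "emeasure (distr M N1 f1 \<Otimes>\<^sub>M distr M N2 f2) E * emeasure (distr Mc N3 Y) D
        = emeasure (distr Mc ((N1 \<Otimes>\<^sub>M N2) \<Otimes>\<^sub>M N3) (\<lambda>\<omega>. ((f1 \<omega>, f2 \<omega>), Y \<omega>))) (E \<times> D)"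
      by (simp add: distr12[symmetric] emeasure_distr emeasure_eq_measure Mc.emeasure_eq_measure ennreal_mult)
  qed (auto intro!: prob_space_imp_sigma_finite prob12 Mc.prob_space_distr cong: sets_pair_measure_cong)
qed

lemma cond_prob_eq_integral:
  assumes M: "prob_space M"
    and indep: "indep_vars3 M N1 f1 N2 f2 (count_space UNIV \<Otimes>\<^sub>M N3) (\<lambda>\<omega>. (S \<omega>, Y \<omega>))"
    and pos: "\<P>(\<omega> in M. S \<omega> = c) > 0"
    and K: "prob_space K" "sets K = sets N3"
    and law: "\<And>A. A \<in> sets N3 \<Longrightarrow> \<P>(\<omega> in M. Y \<omega> \<in> A \<bar> S \<omega> = c) = measure K A"
    and P: "Measurable.pred ((N1 \<Otimes>\<^sub>M N2) \<Otimes>\<^sub>M N3) (\<lambda>q. P (fst (fst q)) (snd (fst q)) (snd q))"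
  shows "\<P>(\<omega> in M. P (f1 \<omega>) (f2 \<omega>) (Y \<omega>) \<bar> S \<omega> = c)
      = (\<integral>p. measure K {y \<in> space K. P (fst p) (snd p) y} \<partial>(distr M N1 f1 \<Otimes>\<^sub>M distr M N2 f2))"
proof -
  interpret prob_space M by fact
  interpret K: prob_space K by fact
  have [measurable]: "f1 \<in> measurable M N1" "f2 \<in> measurable M N2"
    and SY: "(\<lambda>\<omega>. (S \<omega>, Y \<omega>)) \<in> measurable M (count_space UNIV \<Otimes>\<^sub>M N3)"
    using indep by (simp_all add: indep_vars3_def)
  have [measurable]: "S \<in> measurable M (count_space UNIV)" and [measurable]: "Y \<in> measurable M N3"
    using measurable_compose[OF SY measurable_fst] measurable_compose[OF SY measurable_snd] by simp_all
  let ?c = "{\<omega> \<in> space M. S \<omega> = c}"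
  define Mc where "Mc = uniform_measure M ?c"
  have c0: "emeasure M ?c \<noteq> 0" "emeasure M ?c \<noteq> \<infinity>"
    using pos by (simp_all add: emeasure_eq_measure)
  have [measurable_cong]: "sets Mc = events" and [simp]: "space Mc = space M"
    by (simp_all add: Mc_def)
  interpret Mc: prob_space Mc
    unfolding Mc_def by (rule prob_space_uniform_measure[OF c0])
  have [simp]: "space K = space N3"
    by (rule sets_eq_imp_space_eq) fact
  have Mc_prob: "Mc.prob {\<omega> \<in> space M. Q \<omega>} = \<P>(\<omega> in M. Q \<omega> \<bar> S \<omega> = c)"
    if "{\<omega> \<in> space M. Q \<omega>} \<in> events" for Q
    unfolding Mc_def using that measure_uniform_measure[OF c0, of "{\<omega> \<in> space M. Q \<omega>}"]
    by (auto simp: cond_prob_def intro!: arg_cong[where f = prob] arg_cong2[where f = "(/)"])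
  have "distr Mc N3 Y = K"
  proof (rule measure_eqI)
    fix A assume "A \<in> sets (distr Mc N3 Y)"
    then have A [measurable]: "A \<in> sets N3" by simp
    have "Y -` A \<inter> space M = {\<omega> \<in> space M. Y \<omega> \<in> A}"
      by auto
    then show "emeasure (distr Mc N3 Y) A = emeasure K A"
      using law[OF A] Mc_prob[of "\<lambda>\<omega>. Y \<omega> \<in> A"]
      by (simp add: emeasure_distr Mc.emeasure_eq_measure K.emeasure_eq_measure)
  qed (simp add: K)
  then have joint: "distr Mc ((N1 \<Otimes>\<^sub>M N2) \<Otimes>\<^sub>M N3) (\<lambda>\<omega>. ((f1 \<omega>, f2 \<omega>), Y \<omega>))
      = (distr M N1 f1 \<Otimes>\<^sub>M distr M N2 f2) \<Otimes>\<^sub>M K" (is "?D = ?N12 \<Otimes>\<^sub>M K")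
    using distr_cond_eq_pair_measure[OF M indep pos] by (simp add: Mc_def)
  let ?A = "{q \<in> space ?D. P (fst (fst q)) (snd (fst q)) (snd q)}"
  have P': "?A \<in> sets ((N1 \<Otimes>\<^sub>M N2) \<Otimes>\<^sub>M N3)"
    using P by (simp add: pred_def)
  then have A: "?A \<in> sets (?N12 \<Otimes>\<^sub>M K)"
    unfolding joint[symmetric] by simp
  have vimage: "(\<lambda>\<omega>. ((f1 \<omega>, f2 \<omega>), Y \<omega>)) -` ?A \<inter> space M = {\<omega> \<in> space M. P (f1 \<omega>) (f2 \<omega>) (Y \<omega>)}"
    by (auto simp: space_pair_measure intro!: measurable_space[of _ M])
  have ev: "{\<omega> \<in> space M. P (f1 \<omega>) (f2 \<omega>) (Y \<omega>)} \<in> events"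
    unfolding vimage[symmetric] using P' by measurable
  have "\<P>(\<omega> in M. P (f1 \<omega>) (f2 \<omega>) (Y \<omega>) \<bar> S \<omega> = c) = measure ?D ?A"
  proof (subst measure_distr)
    show "\<P>(\<omega> in M. P (f1 \<omega>) (f2 \<omega>) (Y \<omega>) \<bar> S \<omega> = c)
        = Mc.prob ((\<lambda>\<omega>. ((f1 \<omega>, f2 \<omega>), Y \<omega>)) -` ?A \<inter> space Mc)"
      unfolding \<open>space Mc = space M\<close> vimage Mc_prob[OF ev] ..
  qed (use P' in simp_all)
  also have "\<dots> = measure (?N12 \<Otimes>\<^sub>M K) ?A"
    by (simp only: joint)
  also have "\<dots> = enn2real (\<integral>\<^sup>+p. emeasure K (Pair p -` ?A) \<partial>?N12)"
    unfolding measure_def K.emeasure_pair_measure_alt[OF A] ..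
  also have "\<dots> = (\<integral>p. measure K (Pair p -` ?A) \<partial>?N12)"
  proof (subst integral_eq_nn_integral)
    show "(\<lambda>p. measure K (Pair p -` ?A)) \<in> borel_measurable ?N12"
      unfolding measure_def using K.measurable_emeasure_Pair[OF A] by (rule measurable_compose) simp
  qed (simp_all add: K.emeasure_eq_measure)
  also have "\<dots> = (\<integral>p. measure K {y \<in> space K. P (fst p) (snd p) y} \<partial>?N12)"
    by (rule Bochner_Integration.integral_cong)
      (auto simp: space_pair_measure vimage_def intro!: arg_cong[where f = K.prob])
  finally show ?thesis .
qed

section \<open>The distance rule beats guessing\<close>

theorem mainTheorem1:
  fixes \<mu> \<epsilon> \<sigma> :: real
    and M :: "'a measure"
    and X Z Y :: "'a \<Rightarrow> real"
    and S :: "'a \<Rightarrow> component"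
  assumes "\<epsilon> \<noteq> 0"
    and "\<sigma>\<^sup>2 > 0"
    and "prob_space M"
    and indep: "indep_vars3 M borel X borel Z
                  (count_space UNIV \<Otimes>\<^sub>M borel) (\<lambda>\<omega>. (S \<omega>, Y \<omega>))"
    and law_X: "distr M borel X = gaussian \<mu> (\<sigma>\<^sup>2)"
    and law_Z: "distr M borel Z = gaussian (\<mu> + \<epsilon>) (\<sigma>\<^sup>2)"
    and fair_coin: "\<And>c. \<P>(\<omega> in M. S \<omega> = c) = 1 / 2"
    and law_Y: "\<And>c A. A \<in> sets borel \<Longrightarrow>
                  \<P>(\<omega> in M. Y \<omega> \<in> A \<bar> S \<omega> = c) = measure (component_law \<mu> \<epsilon> (\<sigma>\<^sup>2) c) A"
  shows "\<P>(\<omega> in M. C_dist (X \<omega>) (Z \<omega>) (Y \<omega>) = Some (S \<omega>)) =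
           1 / 2 * \<P>(\<omega> in M. \<bar>X \<omega> - Y \<omega>\<bar> < \<bar>Z \<omega> - Y \<omega>\<bar> \<bar> S \<omega> = CompX) +
           1 / 2 * \<P>(\<omega> in M. \<bar>X \<omega> - Y \<omega>\<bar> > \<bar>Z \<omega> - Y \<omega>\<bar> \<bar> S \<omega> = CompZ)
       \<and> 1 / 2 * \<P>(\<omega> in M. \<bar>X \<omega> - Y \<omega>\<bar> < \<bar>Z \<omega> - Y \<omega>\<bar> \<bar> S \<omega> = CompX) +
           1 / 2 * \<P>(\<omega> in M. \<bar>X \<omega> - Y \<omega>\<bar> > \<bar>Z \<omega> - Y \<omega>\<bar> \<bar> S \<omega> = CompZ) > 1 / 2"
proof -
  interpret prob_space M by fact
  let ?v = "\<sigma>\<^sup>2" and ?NX = "gaussian \<mu> (\<sigma>\<^sup>2)" and ?NZ = "gaussian (\<mu> + \<epsilon>) (\<sigma>\<^sup>2)"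
  interpret NX: prob_space ?NX by (rule prob_space_gaussian) fact
  interpret NZ: prob_space ?NZ by (rule prob_space_gaussian) fact
  interpret ZX: pair_prob_space ?NZ ?NX ..
  have X [measurable]: "X \<in> borel_measurable M" and Z [measurable]: "Z \<in> borel_measurable M"
    and SY: "(\<lambda>\<omega>. (S \<omega>, Y \<omega>)) \<in> measurable M (count_space UNIV \<Otimes>\<^sub>M borel)"
    using indep by (simp_all add: indep_vars3_def)
  have S [measurable]: "S \<in> measurable M (count_space UNIV)" and Y [measurable]: "Y \<in> borel_measurable M"
    using measurable_compose[OF SY measurable_fst] measurable_compose[OF SY measurable_snd] by simp_all
  note [measurable] = measurable_closer_prob[OF \<open>\<sigma>\<^sup>2 > 0\<close>]

  have K: "prob_space (component_law \<mu> \<epsilon> ?v c)"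
      "sets (component_law \<mu> \<epsilon> ?v c) = sets borel" for c
    using prob_space_gaussian[OF \<open>\<sigma>\<^sup>2 > 0\<close>] by (cases c; simp)+
  have cond: "\<P>(\<omega> in M. P (X \<omega>) (Z \<omega>) (Y \<omega>) \<bar> S \<omega> = c)
      = (\<integral>p. measure (component_law \<mu> \<epsilon> ?v c) {y. P (fst p) (snd p) y} \<partial>(?NX \<Otimes>\<^sub>M ?NZ))"
    if P: "Measurable.pred ((borel \<Otimes>\<^sub>M borel) \<Otimes>\<^sub>M borel) (\<lambda>q. P (fst (fst q)) (snd (fst q)) (snd q))" for P c
    using cond_prob_eq_integral[OF \<open>prob_space M\<close> indep _ K law_Y P, of c] fair_coin[of c]
      sets_eq_imp_space_eq[OF K(2)[of c]]
    by (simp add: law_X law_Z)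

  have "\<P>(\<omega> in M. \<bar>X \<omega> - Y \<omega>\<bar> < \<bar>Z \<omega> - Y \<omega>\<bar> \<bar> S \<omega> = CompX)
      = (\<integral>p. closer_prob \<mu> ?v (fst p) (snd p) \<partial>(?NX \<Otimes>\<^sub>M ?NZ))"
    using cond[of "\<lambda>x z y. \<bar>x - y\<bar> < \<bar>z - y\<bar>" CompX] by (simp add: closer_prob_def)
  then have X_half: "\<P>(\<omega> in M. \<bar>X \<omega> - Y \<omega>\<bar> < \<bar>Z \<omega> - Y \<omega>\<bar> \<bar> S \<omega> = CompX) > 1 / 2"
    using mean_closer_prob_gt_half[OF \<open>\<epsilon> \<noteq> 0\<close> \<open>\<sigma>\<^sup>2 > 0\<close>, of \<mu>] by simp

  \<comment> \<open>Seen from \<open>\<mu> + \<epsilon>\<close>, now the law shared by \<open>Z\<close> and \<open>Y\<close>, the outlier \<open>X\<close> is shifted by \<open>- \<epsilon>\<close>.\<close>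
  have "\<P>(\<omega> in M. \<bar>Z \<omega> - Y \<omega>\<bar> < \<bar>X \<omega> - Y \<omega>\<bar> \<bar> S \<omega> = CompZ)
      = (\<integral>p. closer_prob (\<mu> + \<epsilon>) ?v (snd p) (fst p) \<partial>(?NX \<Otimes>\<^sub>M ?NZ))"
    using cond[of "\<lambda>x z y. \<bar>z - y\<bar> < \<bar>x - y\<bar>" CompZ] by (simp add: closer_prob_def)
  also have "\<dots> = (\<integral>p. closer_prob (\<mu> + \<epsilon>) ?v (fst p) (snd p) \<partial>(?NZ \<Otimes>\<^sub>M ?NX))"
    using ZX.integral_product_swap[of "\<lambda>p. closer_prob (\<mu> + \<epsilon>) ?v (fst p) (snd p)"]
    by (simp add: split_beta')
  finally have Z_half: "\<P>(\<omega> in M. \<bar>Z \<omega> - Y \<omega>\<bar> < \<bar>X \<omega> - Y \<omega>\<bar> \<bar> S \<omega> = CompZ) > 1 / 2"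
    using mean_closer_prob_gt_half[of "- \<epsilon>" ?v "\<mu> + \<epsilon>"] \<open>\<epsilon> \<noteq> 0\<close> \<open>\<sigma>\<^sup>2 > 0\<close> by simp

  have "{\<omega> \<in> space M. C_dist (X \<omega>) (Z \<omega>) (Y \<omega>) = Some (S \<omega>)}
      = {\<omega> \<in> space M. \<bar>X \<omega> - Y \<omega>\<bar> < \<bar>Z \<omega> - Y \<omega>\<bar> \<and> S \<omega> = CompX}
        \<union> {\<omega> \<in> space M. \<bar>Z \<omega> - Y \<omega>\<bar> < \<bar>X \<omega> - Y \<omega>\<bar> \<and> S \<omega> = CompZ}"
    by (auto simp: C_dist_def split: if_splits)
  then have "\<P>(\<omega> in M. C_dist (X \<omega>) (Z \<omega>) (Y \<omega>) = Some (S \<omega>))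
      = \<P>(\<omega> in M. \<bar>X \<omega> - Y \<omega>\<bar> < \<bar>Z \<omega> - Y \<omega>\<bar> \<and> S \<omega> = CompX)
        + \<P>(\<omega> in M. \<bar>Z \<omega> - Y \<omega>\<bar> < \<bar>X \<omega> - Y \<omega>\<bar> \<and> S \<omega> = CompZ)"
    by (simp only:) (rule finite_measure_Union; auto)
  then show ?thesis
    using X_half Z_half by (simp add: cond_prob_def fair_coin)
qed

end
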